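(* Let $\mathcal{A}$ be an associative algebra over a field $\mathbb{F}$ and let $R:\mathcal{A}\to\mathcal{A}$ be a linear map such that $R(R(x))=R(x)$ and $R(x)\cdot R(y)=R(x\cdot y)$ for all $x,y\in\mathcal{A}$. Then the bracket $$[x,y]=x\cdot R(y)-y\cdot R(x)$$ defines a Lie algebra structure on $\mathcal{A}$. Respectively, the bracket $$[x,y]=R(x)\cdot y-R(y)\cdot x$$ also defines a Lie algebra structure on $\mathcal{A}$.
   Context: Associative algebras are not assumed to be unital or commutative. A Lie algebra over a field $\mathbb{F}$ is a vector space $\mathfrak{g}$ over $\mathbb{F}$ with a bilinear operation $[\,,]:\mathfrak{g}\times\mathfrak{g}\to\mathfrak{g}$ satisfying, for all $x,y,z$, antisymmetry $[x,y]=-[y,x]$ and the Jacobi identity $[x,[y,z]]+[z,[x,y]]+[y,[z,x]]=0$. *)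

theory Defs
  imports Main "HOL.Vector_Spaces"
begin

(* The class ring demands neither a unit nor commutativity; it supplies the
   associative, biadditive product. *)
locale associative_algebra = vector_space scale
  for scale :: "'f::field \<Rightarrow> 'a::ring \<Rightarrow> 'a" (infixr \<open>*s\<close> 75) +
  assumes mult_scale_left: "(c *s x) * y = c *s (x * y)"
    and mult_scale_right: "x * (c *s y) = c *s (x * y)"

(* Antisymmetry rather than the alternating law [x,x] = 0: in characteristic 2
   this is the weaker of the two conventions. *)
locale lie_algebra = vector_space scale
  for scale :: "'f::field \<Rightarrow> 'a::ab_group_add \<Rightarrow> 'a" (infixr \<open>*s\<close> 75) +
  fixes bracket :: "'a \<Rightarrow> 'a \<Rightarrow> 'a"
  assumes bracket_linear_left: "Vector_Spaces.linear scale scale (\<lambda>x. bracket x y)"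
    and bracket_linear_right: "Vector_Spaces.linear scale scale (\<lambda>y. bracket x y)"
    and bracket_antisym: "bracket x y = - bracket y x"
    and jacobi: "bracket x (bracket y z) + bracket z (bracket x y) + bracket y (bracket z x) = 0"

end

theory Submission
  imports Defs
begin

text \<open>
  Each bracket is the commutator of a new product on the algebra, namely
  \<open>x \<circ> y = x * R y\<close> in the first case and \<open>x \<circ> y = R x * y\<close> in the second.
  Because \<open>R\<close> is an idempotent algebra endomorphism, \<open>R (x \<circ> y) = R x * R y\<close> for both
  products, and so both are associative: for the first one,
  \<open>(x \<circ> y) \<circ> z = x * R y * R z = x \<circ> (y \<circ> z)\<close>, and symmetrically for the second.
  The commutator of a bilinear associative product is always a Lie bracket.
\<close>

text \<open>
  Expanding the three double commutators by bilinearity yields twelve triple products. Once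
  they are all bracketed to the left, each of the six orderings of the three elements occurs
  twice, with opposite signs.
\<close>

lemma lie_algebra_commutator:
  fixes scale :: "'f::field \<Rightarrow> 'a::ab_group_add \<Rightarrow> 'a"
    and p :: "'a \<Rightarrow> 'a \<Rightarrow> 'a"
  assumes left: "\<And>y. Vector_Spaces.linear scale scale (\<lambda>x. p x y)"
    and right: "\<And>x. Vector_Spaces.linear scale scale (p x)"
    and assoc: "\<And>x y z. p (p x y) z = p x (p y z)"
  shows "lie_algebra scale (\<lambda>x y. p x y - p y x)"
proof -
  interpret vector_space scale
    using right[of undefined] by (simp add: linear_iff)
  interpret endo: vector_space_pair scale scale
    by unfold_locales
  have diff_left: "p (x - y) z = p x z - p y z" for x y z
    using endo.linear_diff[OF left] .
  have diff_right: "p x (y - z) = p x y - p x z" for x y z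
    using endo.linear_diff[OF right] .
  show ?thesis
  proof (intro lie_algebra.intro lie_algebra_axioms.intro)
    show "Vector_Spaces.linear scale scale (\<lambda>x. p x y - p y x)" for y
      by (rule endo.linear_compose_sub[OF left right])
    show "Vector_Spaces.linear scale scale (\<lambda>y. p x y - p y x)" for x
      by (rule endo.linear_compose_sub[OF right left])
  qed (simp_all add: vector_space_axioms diff_left diff_right assoc)
qed

theorem proposition1p1p3:
  fixes scale :: "'f::field \<Rightarrow> 'a::ring \<Rightarrow> 'a"
    and R :: "'a \<Rightarrow> 'a"
  assumes "associative_algebra scale"
    and "Vector_Spaces.linear scale scale R"
    and "\<And>x. R (R x) = R x"
    and "\<And>x y. R x * R y = R (x * y)"
  shows "lie_algebra scale (\<lambda>x y. x * R y - y * R x) \<and>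
    lie_algebra scale (\<lambda>x y. R x * y - R y * x)"
proof
  interpret associative_algebra scale by fact
  have R_add: "R (x + y) = R x + R y" and R_scale: "R (scale c x) = scale c (R x)" for x y c
    using assms(2) by (simp_all add: linear_iff)
  have R_mult: "R (x * y) = R x * R y" for x y
    using assms(4) by simp
  note bilinear = linear_iff vector_space_axioms R_add R_scale
    mult_scale_left mult_scale_right distrib_left distrib_right
  show "lie_algebra scale (\<lambda>x y. x * R y - y * R x)"
    by (rule lie_algebra_commutator) (simp_all add: bilinear R_mult assms(3) mult.assoc)
  show "lie_algebra scale (\<lambda>x y. R x * y - R y * x)"
    by (rule lie_algebra_commutator) (simp_all add: bilinear R_mult assms(3) mult.assoc)
qed

end
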